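(* Let $T>0$, $r>0$, $0<\gamma<1$, $\rho\in(-1,1)$, let $a,b,\beta,\mu_1,\mu_2,\delta_1,\delta_2$ be real constants, and let $\sigma_1=\sigma_1(t,x)$ and $\sigma_2=\sigma_2(t,y)$ be local volatility functions. Write $z=a+bt+x+\beta y$. Let $g(t,x,y)$ satisfy the Hamilton-Jacobi-Bellman equation $$\begin{aligned} -g_t-\sup_{\pi_1,\pi_2}\Big\{&[\pi_1(\mu_1+\delta_1 z)+\pi_2(\mu_2+\delta_2 z)]\gamma g+r(1-\pi_1-\pi_2)\gamma g\\ &+\big(\mu_1-\tfrac12\sigma_1^2+\delta_1 z\big)g_x+\big(\mu_2-\tfrac12\sigma_2^2+\delta_2 z\big)g_y\\ &+(\pi_1\sigma_1^2+\pi_2\rho\sigma_1\sigma_2)\gamma g_x+(\pi_2\sigma_2^2+\pi_1\rho\sigma_1\sigma_2)\gamma g_y\\ &+\tfrac12\sigma_1^2 g_{xx}+\tfrac12\sigma_2^2 g_{yy}+\rho\sigma_1\sigma_2 g_{xy}\\ &+\tfrac12(\pi_1^2\sigma_1^2+\pi_2^2\sigma_2^2+2\pi_1\pi_2\rho\sigma_1\sigma_2)\gamma(\gamma-1)g\Big\}=0 \end{aligned}$$ for all $0\le t<T$, $x$ and $y$, with $g(T,x,y)=1$ for all $x$ and $y$. Then, at the level of a formal computation, the following hold. (i) The optimal controls in this equation are $$\pi_1^*=\frac{\mu_1-r+\delta_1 z}{\sigma_1^2(1-\gamma)(1-\rho^2)}-\rho\frac{\mu_2-r+\delta_2 z}{\sigma_1\sigma_2(1-\gamma)(1-\rho^2)}+\frac{g_x}{(1-\gamma)g},$$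 $$\pi_2^*=\frac{\mu_2-r+\delta_2 z}{\sigma_2^2(1-\gamma)(1-\rho^2)}-\rho\frac{\mu_1-r+\delta_1 z}{\sigma_1\sigma_2(1-\gamma)(1-\rho^2)}+\frac{g_y}{(1-\gamma)g}.$$ (ii) With $\tau=T-t$, the function $\phi(\tau,x,y)$ defined by $g(t,x,y)=\frac{1}{1-\gamma}\phi^{1-\gamma}(\tau,x,y)$ satisfies the linear equation $$\begin{aligned} \phi_\tau&-\frac{\gamma}{2(\gamma-1)^2(1-\rho^2)}\left[\frac{(\mu_1+\delta_1 z-r)^2}{\sigma_1^2}+\frac{(\mu_2+\delta_2 z-r)^2}{\sigma_2^2}-2\rho\frac{(\mu_1-r+\delta_1 z)(\mu_2-r+\delta_2 z)}{\sigma_1\sigma_2}\right]\phi\\ &-\frac{r\gamma}{1-\gamma}\phi+\frac{\mu_1+\delta_1 z}{\gamma-1}\phi_x-\frac{r\gamma}{\gamma-1}\phi_x+\frac12\sigma_1^2\phi_x+\frac{\mu_2+\delta_2 z}{\gamma-1}\phi_y-\frac{r\gamma}{\gamma-1}\phi_y+\frac12\sigma_2^2\phi_y\\ &-\frac12\sigma_1^2\phi_{xx}-\frac12\sigma_2^2\phi_{yy}-\rho\sigma_1\sigma_2\phi_{xy}=0, \end{aligned}$$ with the initial condition $\phi(0,x,y)=(1-\gamma)^{\frac1{1-\gamma}}$, where $\sigma_1,\sigma_2,z$ are evaluated at $t=T-\tau$. (iii) In terms of $\phi$, the controls are $$\pi_1^*=\frac{\mu_1-r+\delta_1 z}{\sigma_1^2(1-\gamma)(1-\rho^2)}-\rho\frac{\mu_2-r+\delta_2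 z}{\sigma_1\sigma_2(1-\gamma)(1-\rho^2)}+\frac{\phi_x}{\phi},$$ $$\pi_2^*=\frac{\mu_2-r+\delta_2 z}{\sigma_2^2(1-\gamma)(1-\rho^2)}-\rho\frac{\mu_1-r+\delta_1 z}{\sigma_1\sigma_2(1-\gamma)(1-\rho^2)}+\frac{\phi_y}{\phi}.$$ In particular, this applies to the Constant Elasticity of Variance choice, in which $\sigma_1(t,x)=s_1e^{\theta_1x}$ and $\sigma_2(t,y)=s_2e^{\theta_2y}$ with constants $s_1,s_2>0$ and $\theta_1,\theta_2\in(-1,0)$.
   Context: Subscripts $t,\tau,x,y$ on $g$ and $\phi$ denote partial derivatives. In the equations, $\sigma_1$ and $\sigma_2$ abbreviate $\sigma_1(t,x)$ and $\sigma_2(t,y)$. The derivation is formal: no regularity of $g$ or $\phi$ is established, and only the implication from the equation for $g$ to the equation for $\phi$ is asserted. Background: $x,y$ are the log-prices of two co-integrated assets with log-price drifts $\mu_i-\frac12\sigma_i^2+\delta_i z$ and volatilities $\sigma_i$, driven by Brownian motions with correlation $\rho$; $\pi_1,\pi_2$ are the fractions of wealth invested in them; $r$ is the risk-free rate; and $u(t,w,x,y)=\frac1\gamma w^\gamma g(t,x,y)$ is the value function for maximizing the expected power utility $\frac1\gamma w^\gamma$ of terminal wealth at time $T$, starting from wealth $w$. *)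

theory Defs
  imports "HOL-Analysis.Analysis"
begin

section \<open>Partial derivatives of functions of time and two space variables\<close>

text \<open>
  Functions live on \<open>[0,T] \<times> \<real> \<times> \<real>\<close>; the time derivative is taken within \<open>[0,T]\<close>, hence it is
  the two-sided derivative at interior times and the one-sided derivative at the end points.
\<close>

type_synonym field3 = "real \<Rightarrow> real \<Rightarrow> real \<Rightarrow> real"

definition D_time :: "real \<Rightarrow> field3 \<Rightarrow> field3" where
  "D_time T f t x y = vector_derivative (\<lambda>s. f s x y) (at t within {0..T})"

definition D_x :: "field3 \<Rightarrow> field3" where
  "D_x f t x y = deriv (\<lambda>u. f t u y) x"

definition D_y :: "field3 \<Rightarrow> field3" where
  "D_y f t x y = deriv (\<lambda>v. f t x v) y"

text \<open>
  Existence of exactly those partial derivatives that occur in the equations; the mixed derivative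
  \<open>f\<^sub>x\<^sub>y\<close> is \<open>D_y (D_x f)\<close>.
\<close>

definition has_partials_on :: "real \<Rightarrow> real set \<Rightarrow> field3 \<Rightarrow> bool" where
  "has_partials_on T I f \<longleftrightarrow> (\<forall>t\<in>I. \<forall>x y.
     (\<lambda>s. f s x y) differentiable (at t within {0..T}) \<and>
     (\<lambda>u. f t u y) differentiable (at x) \<and>
     (\<lambda>v. f t x v) differentiable (at y) \<and>
     (\<lambda>u. D_x f t u y) differentiable (at x) \<and>
     (\<lambda>v. D_y f t x v) differentiable (at y) \<and>
     (\<lambda>v. D_x f t x v) differentiable (at y))"


section \<open>The market model\<close>

record market =
  horizon :: real        \<comment> \<open>\<open>T\<close>\<close>
  rate :: real           \<comment> \<open>\<open>r\<close>\<close>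
  utility_exp :: real    \<comment> \<open>\<open>\<gamma>\<close>\<close>
  corr :: real           \<comment> \<open>\<open>\<rho>\<close>\<close>
  coint_a :: real
  coint_b :: real
  coint_beta :: real
  drift_mu1 :: real
  drift_mu2 :: real
  drift_delta1 :: real
  drift_delta2 :: real

definition coint :: "market \<Rightarrow> field3" where
  "coint M t x y = coint_a M + coint_b M * t + x + coint_beta M * y"

text \<open>The terms \<open>\<mu>\<^sub>i + \<delta>\<^sub>i z\<close>.\<close>

definition drift1 :: "market \<Rightarrow> field3" where
  "drift1 M t x y = drift_mu1 M + drift_delta1 M * coint M t x y"

definition drift2 :: "market \<Rightarrow> field3" where
  "drift2 M t x y = drift_mu2 M + drift_delta2 M * coint M t x y"

type_synonym volatility = "real \<Rightarrow> real \<Rightarrow> real"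

definition cev :: "real \<Rightarrow> real \<Rightarrow> volatility" where
  "cev s \<theta> t x = s * exp (\<theta> * x)"


section \<open>The Hamilton-Jacobi-Bellman equation\<close>

text \<open>The expression in braces, as a function of the controls \<open>(\<pi>\<^sub>1, \<pi>\<^sub>2)\<close>.\<close>

definition hamiltonian ::
  "market \<Rightarrow> volatility \<Rightarrow> volatility \<Rightarrow> field3 \<Rightarrow> real \<Rightarrow> real \<Rightarrow> real \<Rightarrow> real \<times> real \<Rightarrow> real" where
  "hamiltonian M \<sigma>\<^sub>1 \<sigma>\<^sub>2 g t x y = (\<lambda>(\<pi>\<^sub>1, \<pi>\<^sub>2).
    (let \<gamma> = utility_exp M; r = rate M; \<rho> = corr M;
         m\<^sub>1 = drift1 M t x y; m\<^sub>2 = drift2 M t x y; s\<^sub>1 = \<sigma>\<^sub>1 t x; s\<^sub>2 = \<sigma>\<^sub>2 t y;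
         G = g t x y; G\<^sub>x = D_x g t x y; G\<^sub>y = D_y g t x y;
         G\<^sub>x\<^sub>x = D_x (D_x g) t x y; G\<^sub>y\<^sub>y = D_y (D_y g) t x y; G\<^sub>x\<^sub>y = D_y (D_x g) t x y
     in (\<pi>\<^sub>1 * m\<^sub>1 + \<pi>\<^sub>2 * m\<^sub>2) * \<gamma> * G + r * (1 - \<pi>\<^sub>1 - \<pi>\<^sub>2) * \<gamma> * G
        + (m\<^sub>1 - 1/2 * s\<^sub>1\<^sup>2) * G\<^sub>x + (m\<^sub>2 - 1/2 * s\<^sub>2\<^sup>2) * G\<^sub>y
        + (\<pi>\<^sub>1 * s\<^sub>1\<^sup>2 + \<pi>\<^sub>2 * \<rho> * s\<^sub>1 * s\<^sub>2) * \<gamma> * G\<^sub>x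
        + (\<pi>\<^sub>2 * s\<^sub>2\<^sup>2 + \<pi>\<^sub>1 * \<rho> * s\<^sub>1 * s\<^sub>2) * \<gamma> * G\<^sub>y
        + 1/2 * s\<^sub>1\<^sup>2 * G\<^sub>x\<^sub>x + 1/2 * s\<^sub>2\<^sup>2 * G\<^sub>y\<^sub>y + \<rho> * s\<^sub>1 * s\<^sub>2 * G\<^sub>x\<^sub>y
        + 1/2 * (\<pi>\<^sub>1\<^sup>2 * s\<^sub>1\<^sup>2 + \<pi>\<^sub>2\<^sup>2 * s\<^sub>2\<^sup>2 + 2 * \<pi>\<^sub>1 * \<pi>\<^sub>2 * \<rho> * s\<^sub>1 * s\<^sub>2) * \<gamma> * (\<gamma> - 1) * G))"

text \<open>
  The supremum is taken in the extended reals, so that the equation fails, rather than holding by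
  accident, at points where the supremum is infinite.
\<close>

definition hjb_solution :: "market \<Rightarrow> volatility \<Rightarrow> volatility \<Rightarrow> field3 \<Rightarrow> bool" where
  "hjb_solution M \<sigma>\<^sub>1 \<sigma>\<^sub>2 g \<longleftrightarrow>
     has_partials_on (horizon M) {0..<horizon M} g \<and>
     (\<forall>t\<in>{0..<horizon M}. \<forall>x y.
        - ereal (D_time (horizon M) g t x y)
        - (SUP \<pi>. ereal (hamiltonian M \<sigma>\<^sub>1 \<sigma>\<^sub>2 g t x y \<pi>)) = 0) \<and>
     (\<forall>x y. g (horizon M) x y = 1)"

definition optimal_controls ::
  "market \<Rightarrow> volatility \<Rightarrow> volatility \<Rightarrow> field3 \<Rightarrow> real \<Rightarrow> real \<Rightarrow> real \<Rightarrow> real \<times> real \<Rightarrow> bool" where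
  "optimal_controls M \<sigma>\<^sub>1 \<sigma>\<^sub>2 g t x y \<pi> \<longleftrightarrow>
     is_arg_max (hamiltonian M \<sigma>\<^sub>1 \<sigma>\<^sub>2 g t x y) (\<lambda>_. True) \<pi>"

text \<open>
  The two control formulas; the arguments \<open>h\<^sub>1\<close>, \<open>h\<^sub>2\<close> stand for the last summands, which are
  expressed through \<open>g\<close> or through \<open>\<phi>\<close>.
\<close>

definition control_formula ::
  "market \<Rightarrow> volatility \<Rightarrow> volatility \<Rightarrow> real \<Rightarrow> real \<Rightarrow> real \<Rightarrow> real \<Rightarrow> real \<Rightarrow> real \<times> real" where
  "control_formula M \<sigma>\<^sub>1 \<sigma>\<^sub>2 t x y h\<^sub>1 h\<^sub>2 =
    (let \<gamma> = utility_exp M; r = rate M; \<rho> = corr M;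
         m\<^sub>1 = drift1 M t x y; m\<^sub>2 = drift2 M t x y; s\<^sub>1 = \<sigma>\<^sub>1 t x; s\<^sub>2 = \<sigma>\<^sub>2 t y
     in ((m\<^sub>1 - r) / (s\<^sub>1\<^sup>2 * (1 - \<gamma>) * (1 - \<rho>\<^sup>2))
           - \<rho> * ((m\<^sub>2 - r) / (s\<^sub>1 * s\<^sub>2 * (1 - \<gamma>) * (1 - \<rho>\<^sup>2))) + h\<^sub>1,
         (m\<^sub>2 - r) / (s\<^sub>2\<^sup>2 * (1 - \<gamma>) * (1 - \<rho>\<^sup>2))
           - \<rho> * ((m\<^sub>1 - r) / (s\<^sub>1 * s\<^sub>2 * (1 - \<gamma>) * (1 - \<rho>\<^sup>2))) + h\<^sub>2))"


section \<open>The power transform and the linear equation\<close>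

text \<open>Positivity of \<open>\<phi>\<close> makes the real power \<open>\<phi> powr (1 - \<gamma>)\<close> meaningful.\<close>

definition power_transform :: "market \<Rightarrow> field3 \<Rightarrow> field3 \<Rightarrow> bool" where
  "power_transform M g \<phi> \<longleftrightarrow> (\<forall>t\<in>{0..horizon M}. \<forall>x y.
     \<phi> (horizon M - t) x y > 0 \<and>
     g t x y = 1 / (1 - utility_exp M) * \<phi> (horizon M - t) x y powr (1 - utility_exp M))"

definition linear_lhs :: "market \<Rightarrow> volatility \<Rightarrow> volatility \<Rightarrow> field3 \<Rightarrow> field3" where
  "linear_lhs M \<sigma>\<^sub>1 \<sigma>\<^sub>2 \<phi> \<tau> x y =
    (let \<gamma> = utility_exp M; r = rate M; \<rho> = corr M; t = horizon M - \<tau>;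
         m\<^sub>1 = drift1 M t x y; m\<^sub>2 = drift2 M t x y; s\<^sub>1 = \<sigma>\<^sub>1 t x; s\<^sub>2 = \<sigma>\<^sub>2 t y;
         F = \<phi> \<tau> x y; F\<^sub>x = D_x \<phi> \<tau> x y; F\<^sub>y = D_y \<phi> \<tau> x y;
         F\<^sub>x\<^sub>x = D_x (D_x \<phi>) \<tau> x y; F\<^sub>y\<^sub>y = D_y (D_y \<phi>) \<tau> x y; F\<^sub>x\<^sub>y = D_y (D_x \<phi>) \<tau> x y
     in D_time (horizon M) \<phi> \<tau> x y
        - \<gamma> / (2 * (\<gamma> - 1)\<^sup>2 * (1 - \<rho>\<^sup>2))
            * ((m\<^sub>1 - r)\<^sup>2 / s\<^sub>1\<^sup>2 + (m\<^sub>2 - r)\<^sup>2 / s\<^sub>2\<^sup>2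
               - 2 * \<rho> * ((m\<^sub>1 - r) * (m\<^sub>2 - r) / (s\<^sub>1 * s\<^sub>2))) * F
        - r * \<gamma> / (1 - \<gamma>) * F
        + m\<^sub>1 / (\<gamma> - 1) * F\<^sub>x - r * \<gamma> / (\<gamma> - 1) * F\<^sub>x + 1/2 * s\<^sub>1\<^sup>2 * F\<^sub>x
        + m\<^sub>2 / (\<gamma> - 1) * F\<^sub>y - r * \<gamma> / (\<gamma> - 1) * F\<^sub>y + 1/2 * s\<^sub>2\<^sup>2 * F\<^sub>y
        - 1/2 * s\<^sub>1\<^sup>2 * F\<^sub>x\<^sub>x - 1/2 * s\<^sub>2\<^sup>2 * F\<^sub>y\<^sub>y - \<rho> * s\<^sub>1 * s\<^sub>2 * F\<^sub>x\<^sub>y)"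

definition linear_solution :: "market \<Rightarrow> volatility \<Rightarrow> volatility \<Rightarrow> field3 \<Rightarrow> bool" where
  "linear_solution M \<sigma>\<^sub>1 \<sigma>\<^sub>2 \<phi> \<longleftrightarrow>
     has_partials_on (horizon M) {0<..horizon M} \<phi> \<and>
     (\<forall>\<tau>\<in>{0<..horizon M}. \<forall>x y. linear_lhs M \<sigma>\<^sub>1 \<sigma>\<^sub>2 \<phi> \<tau> x y = 0) \<and>
     (\<forall>x y. \<phi> 0 x y = (1 - utility_exp M) powr (1 / (1 - utility_exp M)))"

text \<open>
  The claim for given volatilities. The solution \<open>g\<close> is only required to be nonzero, which is what
  the control formulas need. The two equivalences state that the displayed controls are the unique
  maximisers.
\<close>

definition reduction_claim :: "market \<Rightarrow> volatility \<Rightarrow> volatility \<Rightarrow> bool" where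
  "reduction_claim M \<sigma>\<^sub>1 \<sigma>\<^sub>2 \<longleftrightarrow> (\<forall>g.
     hjb_solution M \<sigma>\<^sub>1 \<sigma>\<^sub>2 g \<and> (\<forall>t\<in>{0..<horizon M}. \<forall>x y. g t x y \<noteq> 0) \<longrightarrow>
       (\<forall>t\<in>{0..<horizon M}. \<forall>x y \<pi>.
          optimal_controls M \<sigma>\<^sub>1 \<sigma>\<^sub>2 g t x y \<pi> \<longleftrightarrow>
          \<pi> = control_formula M \<sigma>\<^sub>1 \<sigma>\<^sub>2 t x y
                (D_x g t x y / ((1 - utility_exp M) * g t x y))
                (D_y g t x y / ((1 - utility_exp M) * g t x y))) \<and>
       (\<exists>\<phi>. power_transform M g \<phi>) \<and>
       (\<forall>\<phi>. power_transform M g \<phi> \<longrightarrow>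
          linear_solution M \<sigma>\<^sub>1 \<sigma>\<^sub>2 \<phi> \<and>
          (\<forall>t\<in>{0..<horizon M}. \<forall>x y \<pi>.
             optimal_controls M \<sigma>\<^sub>1 \<sigma>\<^sub>2 g t x y \<pi> \<longleftrightarrow>
             \<pi> = control_formula M \<sigma>\<^sub>1 \<sigma>\<^sub>2 t x y
                   (D_x \<phi> (horizon M - t) x y / \<phi> (horizon M - t) x y)
                   (D_y \<phi> (horizon M - t) x y / \<phi> (horizon M - t) x y))))"

end

theory Submission imports Defs begin

text \<open>
  In the controls the Hamiltonian is a quadratic whose leading part is \<open>\<gamma> (\<gamma> - 1) g / 2\<close> times the
  positive definite covariance form. Where \<open>g < 0\<close> its supremum is infinite, so the equation itself
  forces \<open>g > 0\<close>; there completing the square gives the unique maximiser and the value of the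
  supremum. Under \<open>g = \<phi>\<^sup>1\<^sup>-\<^sup>\<gamma> / (1 - \<gamma>)\<close> the quadratic gradient term of that value cancels
  against the one produced by the second derivatives of the power, because both carry the covariance
  matrix; what remains is linear in \<open>\<phi>\<close>.
\<close>

section \<open>Scaled powers, the covariance form and the first-order conditions\<close>

text \<open>The logarithmic derivative of \<open>(c * f u) powr p\<close> is
  \<open>p * D / f x\<close>, free of \<open>c\<close>. Writing the derivative as a multiple of the
  power itself lets all derivatives of \<phi> be expressed by \<phi> and those of
  \<open>g\<close>.\<close>

lemma has_real_derivative_scaled_powr:
  fixes f :: "real \<Rightarrow> real"
  assumes "(f has_real_derivative D) (at x within S)" and "f x > 0" and "c > 0" and "x \<in> S"
  shows "((\<lambda>u. (c * f u) powr p) has_real_derivative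
           p * (c * f x) powr p * D / f x) (at x within S)"
  using assms
  by (auto intro!: derivative_eq_intros simp: field_simps powr_diff)

text \<open>Completing the square in \<open>d1 * s1\<close> leaves
  \<open>(1 - \<rho>\<^sup>2) * (d2 * s2)\<^sup>2\<close>. The bound on \<rho> makes this positive
  unless \<open>d2 = 0\<close>, and then \<open>d1\<close> is nonzero and the square is
  positive.\<close>

lemma quadratic_form_pos:
  fixes s1 s2 \<rho> d1 d2 :: real
  assumes "s1 \<noteq> 0" "s2 \<noteq> 0" "-1 < \<rho>" "\<rho> < 1" "(d1, d2) \<noteq> (0, 0)"
  shows "d1\<^sup>2 * s1\<^sup>2 + d2\<^sup>2 * s2\<^sup>2 + 2 * d1 * d2 * \<rho> * s1 * s2 > 0"
proof -
  have r: "1 - \<rho>\<^sup>2 > 0"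
    using assms by (simp add: abs_square_less_1)
  have "d1\<^sup>2 * s1\<^sup>2 + d2\<^sup>2 * s2\<^sup>2 + 2 * d1 * d2 * \<rho> * s1 * s2
      = (d1 * s1 + \<rho> * (d2 * s2))\<^sup>2 + (1 - \<rho>\<^sup>2) * (d2 * s2)\<^sup>2"
    by (simp add: power2_eq_square algebra_simps)
  also have "\<dots> > 0"
  proof (cases "d2 = 0")
    case True
    then show ?thesis using assms by simp
  next
    case False
    then show ?thesis using assms r by (intro add_nonneg_pos mult_pos_pos) auto
  qed
  finally show ?thesis .
qed

text \<open>With \<open>c\<close> in the role of 1 - \<gamma>, \<open>E1\<close> and
  \<open>E2\<close> are the gradient of the Hamiltonian at zero controls divided by \<gamma>. The
  first two equations say that the gradient vanishes at \<open>(P1, P2)\<close>; the third evaluates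
  the linear part there, half of which enters the maximal value.\<close>

lemma first_order_conditions:
  fixes m1 m2 r s1 s2 \<rho> c G Gx Gy :: real
  defines "P1 \<equiv> (m1 - r) / (s1\<^sup>2 * c * (1 - \<rho>\<^sup>2)) - \<rho> * ((m2 - r) / (s1 * s2 * c * (1 - \<rho>\<^sup>2))) + Gx / (c * G)"
    and "P2 \<equiv> (m2 - r) / (s2\<^sup>2 * c * (1 - \<rho>\<^sup>2)) - \<rho> * ((m1 - r) / (s1 * s2 * c * (1 - \<rho>\<^sup>2))) + Gy / (c * G)"
    and "E1 \<equiv> (m1 - r) * G + s1\<^sup>2 * Gx + \<rho> * s1 * s2 * Gy"
    and "E2 \<equiv> (m2 - r) * G + s2\<^sup>2 * Gy + \<rho> * s1 * s2 * Gx"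
  assumes nz: "s1 \<noteq> 0" "s2 \<noteq> 0" "1 - \<rho>\<^sup>2 \<noteq> 0" "c \<noteq> 0" "G \<noteq> 0"
  shows "c * G * (s1\<^sup>2 * P1 + \<rho> * s1 * s2 * P2) = E1"
    and "c * G * (s2\<^sup>2 * P2 + \<rho> * s1 * s2 * P1) = E2"
    and "P1 * E1 + P2 * E2 =
      (G * (((m1 - r)\<^sup>2 / s1\<^sup>2 + (m2 - r)\<^sup>2 / s2\<^sup>2 - 2 * \<rho> * ((m1 - r) * (m2 - r) / (s1 * s2))) / (1 - \<rho>\<^sup>2))
       + 2 * ((m1 - r) * Gx + (m2 - r) * Gy)
       + (s1\<^sup>2 * Gx\<^sup>2 + s2\<^sup>2 * Gy\<^sup>2 + 2 * \<rho> * s1 * s2 * Gx * Gy) / G) / c"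
proof -
  define k where "k = 1 - \<rho>\<^sup>2"
  \<comment> \<open>Dividing the excess drifts by the volatilities (Sharpe ratios) turns the
    covariance matrix into the correlation matrix with off-diagonal entry \<rho>.\<close>
  define a1 where "a1 = (m1 - r) / s1"
  define a2 where "a2 = (m2 - r) / s2"
  have k: "k \<noteq> 0" and k_eq: "k = 1 - \<rho>\<^sup>2" using nz by (auto simp: k_def)
  have m: "m1 - r = a1 * s1" "m2 - r = a2 * s2"
    using nz by (simp_all add: a1_def a2_def)
  \<comment> \<open>\<open>(b1, b2)\<close> is the inverse correlation matrix applied to
    \<open>(a1, a2)\<close>. Expressing \<open>a1\<close> and \<open>a2\<close> through it removes
    the denominator 1 - \<rho>^2 from the remaining identities.\<close>
  define b1 where "b1 = (a1 - \<rho> * a2) / k"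
  define b2 where "b2 = (a2 - \<rho> * a1) / k"
  have P1: "P1 = (b1 + s1 * Gx / G) / (c * s1)"
    and P2: "P2 = (b2 + s2 * Gy / G) / (c * s2)"
    using nz(1,2,4,5) k unfolding P1_def P2_def k_eq[symmetric] m b1_def b2_def
    by (simp_all add: field_simps power2_eq_square)
  have E1: "E1 = s1 * (a1 * G + s1 * Gx + \<rho> * (s2 * Gy))"
    and E2: "E2 = s2 * (a2 * G + s2 * Gy + \<rho> * (s1 * Gx))"
    unfolding E1_def E2_def m by (simp_all add: algebra_simps power2_eq_square)
  have b: "b1 + \<rho> * b2 = a1" "b2 + \<rho> * b1 = a2"
    unfolding b1_def b2_def using k k_eq by (simp_all add: field_simps) algebra+
  show "c * G * (s1\<^sup>2 * P1 + \<rho> * s1 * s2 * P2) = E1"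
    using nz(1,2,4,5) unfolding P1 P2 E1 b(1)[symmetric]
    by (simp add: field_simps power2_eq_square)
  show "c * G * (s2\<^sup>2 * P2 + \<rho> * s1 * s2 * P1) = E2"
    using nz(1,2,4,5) unfolding P1 P2 E2 b(2)[symmetric]
    by (simp add: field_simps power2_eq_square)
  have "((m1 - r)\<^sup>2 / s1\<^sup>2 + (m2 - r)\<^sup>2 / s2\<^sup>2 - 2 * \<rho> * ((m1 - r) * (m2 - r) / (s1 * s2))) / (1 - \<rho>\<^sup>2)
     = (a1\<^sup>2 + a2\<^sup>2 - 2 * \<rho> * (a1 * a2)) / k"
    by (simp add: a1_def a2_def k_eq power_divide)
  also have "\<dots> = b1 * a1 + b2 * a2"
    unfolding b1_def b2_def using k by (simp add: field_simps power2_eq_square)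
  finally have Q: "((m1 - r)\<^sup>2 / s1\<^sup>2 + (m2 - r)\<^sup>2 / s2\<^sup>2 - 2 * \<rho> * ((m1 - r) * (m2 - r) / (s1 * s2))) / (1 - \<rho>\<^sup>2)
     = b1 * a1 + b2 * a2" .
  \<comment> \<open>\<open>Q\<close> is applied before \<open>m\<close>, which would rewrite the
    excess drifts on its left side.\<close>
  show "P1 * E1 + P2 * E2 =
      (G * (((m1 - r)\<^sup>2 / s1\<^sup>2 + (m2 - r)\<^sup>2 / s2\<^sup>2 - 2 * \<rho> * ((m1 - r) * (m2 - r) / (s1 * s2))) / (1 - \<rho>\<^sup>2))
       + 2 * ((m1 - r) * Gx + (m2 - r) * Gy)
       + (s1\<^sup>2 * Gx\<^sup>2 + s2\<^sup>2 * Gy\<^sup>2 + 2 * \<rho> * s1 * s2 * Gx * Gy) / G) / c"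
    using nz(1,2,4,5) unfolding Q unfolding m P1 P2 E1 E2 b[symmetric]
    by (simp add: field_simps power2_eq_square)
qed

section \<open>Maximising the Hamiltonian over the controls\<close>

abbreviation maximiser ::
  "market \<Rightarrow> volatility \<Rightarrow> volatility \<Rightarrow> field3 \<Rightarrow> real \<Rightarrow> real \<Rightarrow> real \<Rightarrow> real \<times> real" where
  "maximiser M \<sigma>\<^sub>1 \<sigma>\<^sub>2 g t x y \<equiv> control_formula M \<sigma>\<^sub>1 \<sigma>\<^sub>2 t x y
     (D_x g t x y / ((1 - utility_exp M) * g t x y)) (D_y g t x y / ((1 - utility_exp M) * g t x y))"

text \<open>The instantaneous variance of the portfolio return with weights \<open>(p, q)\<close>.
  It measures the squared distance from the maximiser in the completed square.\<close>

definition variance_rate ::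
  "market \<Rightarrow> volatility \<Rightarrow> volatility \<Rightarrow> real \<Rightarrow> real \<Rightarrow> real \<Rightarrow> real \<times> real \<Rightarrow> real" where
  "variance_rate M \<sigma>\<^sub>1 \<sigma>\<^sub>2 t x y = (\<lambda>(p, q).
     p\<^sup>2 * (\<sigma>\<^sub>1 t x)\<^sup>2 + q\<^sup>2 * (\<sigma>\<^sub>2 t y)\<^sup>2 + 2 * p * q * corr M * \<sigma>\<^sub>1 t x * \<sigma>\<^sub>2 t y)"

lemma variance_rate_pos:
  assumes "\<sigma>\<^sub>1 t x \<noteq> 0" "\<sigma>\<^sub>2 t y \<noteq> 0" "-1 < corr M" "corr M < 1" "d \<noteq> 0"
  shows "variance_rate M \<sigma>\<^sub>1 \<sigma>\<^sub>2 t x y d > 0"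
  using quadratic_form_pos[OF assms(1-4), of "fst d" "snd d"] assms(5)
  by (simp add: variance_rate_def case_prod_unfold zero_prod_def)

text \<open>A quadratic equals its value at a stationary point plus its second-order part in the
  displacement, and that value is the value at zero plus half of the linear part. Both identities
  hold for either sign of \<open>g\<close>: they give the maximum if \<open>g\<close> is positive
  and unboundedness if it is negative.\<close>

lemma hamiltonian_completed_square:
  assumes gamma: "0 < utility_exp M" "utility_exp M < 1" and rho: "-1 < corr M" "corr M < 1"
    and vol: "\<sigma>\<^sub>1 t x \<noteq> 0" "\<sigma>\<^sub>2 t y \<noteq> 0" and g: "g t x y \<noteq> 0"
  shows "hamiltonian M \<sigma>\<^sub>1 \<sigma>\<^sub>2 g t x y \<pi> =
      hamiltonian M \<sigma>\<^sub>1 \<sigma>\<^sub>2 g t x y (maximiser M \<sigma>\<^sub>1 \<sigma>\<^sub>2 g t x y)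
      - 1/2 * utility_exp M * (1 - utility_exp M) * g t x y
          * variance_rate M \<sigma>\<^sub>1 \<sigma>\<^sub>2 t x y (\<pi> - maximiser M \<sigma>\<^sub>1 \<sigma>\<^sub>2 g t x y)" (is ?square)
    and "hamiltonian M \<sigma>\<^sub>1 \<sigma>\<^sub>2 g t x y (maximiser M \<sigma>\<^sub>1 \<sigma>\<^sub>2 g t x y) =
      hamiltonian M \<sigma>\<^sub>1 \<sigma>\<^sub>2 g t x y 0
      + 1/2 * utility_exp M *
        ((g t x y * (((drift1 M t x y - rate M)\<^sup>2 / (\<sigma>\<^sub>1 t x)\<^sup>2 + (drift2 M t x y - rate M)\<^sup>2 / (\<sigma>\<^sub>2 t y)\<^sup>2
           - 2 * corr M * ((drift1 M t x y - rate M) * (drift2 M t x y - rate M) / (\<sigma>\<^sub>1 t x * \<sigma>\<^sub>2 t y)))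
             / (1 - (corr M)\<^sup>2))
         + 2 * ((drift1 M t x y - rate M) * D_x g t x y + (drift2 M t x y - rate M) * D_y g t x y)
         + ((\<sigma>\<^sub>1 t x)\<^sup>2 * (D_x g t x y)\<^sup>2 + (\<sigma>\<^sub>2 t y)\<^sup>2 * (D_y g t x y)\<^sup>2
             + 2 * corr M * \<sigma>\<^sub>1 t x * \<sigma>\<^sub>2 t y * D_x g t x y * D_y g t x y) / g t x y)
        / (1 - utility_exp M))" (is "_ = _ + 1/2 * _ * ?R")
proof -
  obtain P Q where PQ: "maximiser M \<sigma>\<^sub>1 \<sigma>\<^sub>2 g t x y = (P, Q)" by fastforce
  obtain p q where pq: "\<pi> = (p, q)" by fastforce
  have "1 - (corr M)\<^sup>2 \<noteq> 0" "1 - utility_exp M \<noteq> 0"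
    using rho gamma by (auto simp: abs_square_eq_1)
  note foc = first_order_conditions[where ?m1.0 = "drift1 M t x y" and ?m2.0 = "drift2 M t x y" and r = "rate M"
      and Gx = "D_x g t x y" and Gy = "D_y g t x y", OF vol this g]
  have P: "P = fst (maximiser M \<sigma>\<^sub>1 \<sigma>\<^sub>2 g t x y)" and Q: "Q = snd (maximiser M \<sigma>\<^sub>1 \<sigma>\<^sub>2 g t x y)"
    using PQ by simp_all
  \<comment> \<open>Folding the explicit quotients into \<open>P\<close> and \<open>Q\<close> keeps
    the identities below polynomial.\<close>
  note PQ' = P[unfolded control_formula_def Let_def fst_conv, symmetric]
    Q[unfolded control_formula_def Let_def snd_conv, symmetric]
  let ?X = "(1 - utility_exp M) * g t x y * ((\<sigma>\<^sub>1 t x)\<^sup>2 * P + corr M * \<sigma>\<^sub>1 t x * \<sigma>\<^sub>2 t y * Q)"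
    and ?Y = "(1 - utility_exp M) * g t x y * ((\<sigma>\<^sub>2 t y)\<^sup>2 * Q + corr M * \<sigma>\<^sub>1 t x * \<sigma>\<^sub>2 t y * P)"
    and ?E = "(drift1 M t x y - rate M) * g t x y + (\<sigma>\<^sub>1 t x)\<^sup>2 * D_x g t x y
      + corr M * \<sigma>\<^sub>1 t x * \<sigma>\<^sub>2 t y * D_y g t x y"
    and ?F = "(drift2 M t x y - rate M) * g t x y + (\<sigma>\<^sub>2 t y)\<^sup>2 * D_y g t x y
      + corr M * \<sigma>\<^sub>1 t x * \<sigma>\<^sub>2 t y * D_x g t x y"
  have XY: "?X = ?E" "?Y = ?F" using foc(1,2) unfolding PQ' .
  \<comment> \<open>With the defects \<open>?E - ?X\<close> and \<open>?F - ?Y\<close> included,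
    this is a polynomial identity in arbitrary \<open>P\<close> and \<open>Q\<close>. Stationarity
    enters only afterwards, when \<open>XY\<close> makes the defects vanish.\<close>
  have "hamiltonian M \<sigma>\<^sub>1 \<sigma>\<^sub>2 g t x y (p, q) = hamiltonian M \<sigma>\<^sub>1 \<sigma>\<^sub>2 g t x y (P, Q)
      - 1/2 * utility_exp M * (1 - utility_exp M) * g t x y
          * variance_rate M \<sigma>\<^sub>1 \<sigma>\<^sub>2 t x y (p - P, q - Q)
      + utility_exp M * ((p - P) * (?E - ?X) + (q - Q) * (?F - ?Y))"
    unfolding hamiltonian_def variance_rate_def Let_def case_prod_conv by algebra
  then show ?square
    unfolding PQ pq diff_Pair XY by simp
  \<comment> \<open>Again an identity for arbitrary \<open>P\<close> and \<open>Q\<close>; after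
    \<open>XY\<close> the quadratic part cancels half of the linear part.\<close>
  have "hamiltonian M \<sigma>\<^sub>1 \<sigma>\<^sub>2 g t x y (P, Q) = hamiltonian M \<sigma>\<^sub>1 \<sigma>\<^sub>2 g t x y (0, 0)
      + utility_exp M * (P * ?E + Q * ?F) - 1/2 * utility_exp M * (P * ?X + Q * ?Y)"
    unfolding hamiltonian_def Let_def case_prod_conv
      zero_power2 mult_zero_left mult_zero_right add_0 add_0_right diff_zero
    by algebra
  then have "hamiltonian M \<sigma>\<^sub>1 \<sigma>\<^sub>2 g t x y (P, Q) = hamiltonian M \<sigma>\<^sub>1 \<sigma>\<^sub>2 g t x y (0, 0)
      + 1/2 * utility_exp M * (P * ?E + Q * ?F)"
    unfolding XY by simp
  also have "P * ?E + Q * ?F = ?R" using foc(3) unfolding PQ' .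
  finally show "hamiltonian M \<sigma>\<^sub>1 \<sigma>\<^sub>2 g t x y (maximiser M \<sigma>\<^sub>1 \<sigma>\<^sub>2 g t x y) =
      hamiltonian M \<sigma>\<^sub>1 \<sigma>\<^sub>2 g t x y 0 + 1/2 * utility_exp M * ?R"
    unfolding PQ zero_prod_def .
qed

text \<open>For positive \<open>g\<close> the term subtracted in the completed square vanishes only
  at zero displacement, which gives existence and uniqueness of the maximiser together.\<close>

lemma optimal_controls_iff:
  assumes "0 < utility_exp M" "utility_exp M < 1" "-1 < corr M" "corr M < 1"
    and "\<sigma>\<^sub>1 t x \<noteq> 0" "\<sigma>\<^sub>2 t y \<noteq> 0" and g: "g t x y > 0"
  shows "optimal_controls M \<sigma>\<^sub>1 \<sigma>\<^sub>2 g t x y \<pi> \<longleftrightarrow> \<pi> = maximiser M \<sigma>\<^sub>1 \<sigma>\<^sub>2 g t x y"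
proof -
  let ?H = "hamiltonian M \<sigma>\<^sub>1 \<sigma>\<^sub>2 g t x y" and ?P = "maximiser M \<sigma>\<^sub>1 \<sigma>\<^sub>2 g t x y"
  have less: "?H \<pi> < ?H ?P" if "\<pi> \<noteq> ?P" for \<pi>
  proof -
    have "0 < 1/2 * utility_exp M * (1 - utility_exp M) * g t x y
        * variance_rate M \<sigma>\<^sub>1 \<sigma>\<^sub>2 t x y (\<pi> - ?P)"
      using assms that by (intro mult_pos_pos variance_rate_pos) auto
    then show ?thesis
      using hamiltonian_completed_square(1)[of M \<sigma>\<^sub>1 t x \<sigma>\<^sub>2 y g \<pi>] assms by linarith
  qed
  show ?thesis
    unfolding optimal_controls_def is_arg_max_linorder
    using less by (metis less_eq_real_def linorder_not_le)
qed

lemma SUP_hamiltonian: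
  assumes "0 < utility_exp M" "utility_exp M < 1" "-1 < corr M" "corr M < 1"
    and "\<sigma>\<^sub>1 t x \<noteq> 0" "\<sigma>\<^sub>2 t y \<noteq> 0" and "g t x y > 0"
  shows "(SUP \<pi>. ereal (hamiltonian M \<sigma>\<^sub>1 \<sigma>\<^sub>2 g t x y \<pi>))
    = ereal (hamiltonian M \<sigma>\<^sub>1 \<sigma>\<^sub>2 g t x y (maximiser M \<sigma>\<^sub>1 \<sigma>\<^sub>2 g t x y))"
proof -
  have "is_arg_max (hamiltonian M \<sigma>\<^sub>1 \<sigma>\<^sub>2 g t x y) (\<lambda>_. True) (maximiser M \<sigma>\<^sub>1 \<sigma>\<^sub>2 g t x y)"
    using optimal_controls_iff[of M \<sigma>\<^sub>1 t x \<sigma>\<^sub>2 y g] assms by (simp add: optimal_controls_def)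
  then show ?thesis
    by (intro antisym SUP_least SUP_upper) (auto simp: is_arg_max_linorder)
qed

text \<open>For negative \<open>g\<close> the completed square adds a positive definite form, so
  moving the first control alone already exceeds every bound.\<close>

lemma SUP_hamiltonian_infinite:
  assumes par: "0 < utility_exp M" "utility_exp M < 1" "-1 < corr M" "corr M < 1"
    and vol: "\<sigma>\<^sub>1 t x \<noteq> 0" "\<sigma>\<^sub>2 t y \<noteq> 0" and g: "g t x y < 0"
  shows "(SUP \<pi>. ereal (hamiltonian M \<sigma>\<^sub>1 \<sigma>\<^sub>2 g t x y \<pi>)) = \<infinity>"
proof (rule SUP_PInfty)
  fix n :: nat
  let ?H = "hamiltonian M \<sigma>\<^sub>1 \<sigma>\<^sub>2 g t x y" and ?P = "maximiser M \<sigma>\<^sub>1 \<sigma>\<^sub>2 g t x y"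
  \<comment> \<open>\<open>k\<close> is the coefficient of \<open>l\<^sup>2\<close> along the
    displacement \<open>(l, 0)\<close>, and \<open>l\<close> is chosen so that
    \<open>k * l\<^sup>2\<close> is the distance from the value at \<open>?P\<close> to
    \<open>n\<close>.\<close>
  define k where "k = 1/2 * utility_exp M * (1 - utility_exp M) * (- g t x y) * (\<sigma>\<^sub>1 t x)\<^sup>2"
  have k: "k > 0" unfolding k_def using assms by (intro mult_pos_pos) auto
  define l where "l = sqrt (\<bar>real n - ?H ?P\<bar> / k)"
  have "?H (?P + (l, 0)) = ?H ?P + k * l\<^sup>2"
    using hamiltonian_completed_square(1)[of M \<sigma>\<^sub>1 t x \<sigma>\<^sub>2 y g "?P + (l, 0)"] assms
    by (simp add: variance_rate_def k_def)
  also have "k * l\<^sup>2 = \<bar>real n - ?H ?P\<bar>"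
    using k by (simp add: l_def)
  finally have "real n \<le> ?H (?P + (l, 0))" by linarith
  then show "\<exists>\<pi>\<in>UNIV. ereal (real n) \<le> ereal (?H \<pi>)"
    by (intro bexI[of _ "?P + (l, 0)"]) auto
qed

section \<open>Consequences of the equation: the sign of g and its time derivative\<close>

lemma hjb_solution_pos:
  assumes par: "0 < utility_exp M" "utility_exp M < 1" "-1 < corr M" "corr M < 1"
    and vol: "\<sigma>\<^sub>1 t x \<noteq> 0" "\<sigma>\<^sub>2 t y \<noteq> 0"
    and hjb: "hjb_solution M \<sigma>\<^sub>1 \<sigma>\<^sub>2 g" and t: "t \<in> {0..<horizon M}" and g: "g t x y \<noteq> 0"
  shows "g t x y > 0"
proof (rule ccontr)
  assume "\<not> g t x y > 0"
  with g have "g t x y < 0" by simp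
  \<comment> \<open>An infinite supremum would make the left side of the equation -\<infinity>
    instead of 0, because the time derivative is a real number.\<close>
  from SUP_hamiltonian_infinite[OF par, of \<sigma>\<^sub>1 t x \<sigma>\<^sub>2 y g, OF vol this] hjb t
  have "- ereal (D_time (horizon M) g t x y) - \<infinity> = 0"
    unfolding hjb_solution_def by metis
  then show False by simp
qed

lemma hjb_solution_D_time:
  assumes par: "0 < utility_exp M" "utility_exp M < 1" "-1 < corr M" "corr M < 1"
    and vol: "\<sigma>\<^sub>1 t x \<noteq> 0" "\<sigma>\<^sub>2 t y \<noteq> 0"
    and hjb: "hjb_solution M \<sigma>\<^sub>1 \<sigma>\<^sub>2 g" and t: "t \<in> {0..<horizon M}" and g: "g t x y \<noteq> 0"
  shows "D_time (horizon M) g t x y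
    = - hamiltonian M \<sigma>\<^sub>1 \<sigma>\<^sub>2 g t x y (maximiser M \<sigma>\<^sub>1 \<sigma>\<^sub>2 g t x y)"
proof -
  have "- ereal (D_time (horizon M) g t x y)
      - ereal (hamiltonian M \<sigma>\<^sub>1 \<sigma>\<^sub>2 g t x y (maximiser M \<sigma>\<^sub>1 \<sigma>\<^sub>2 g t x y)) = 0"
    using hjb t SUP_hamiltonian[OF par, of \<sigma>\<^sub>1 t x \<sigma>\<^sub>2 y g, OF vol
        hjb_solution_pos[OF par, of \<sigma>\<^sub>1 t x \<sigma>\<^sub>2 y g, OF vol hjb t g]]
    unfolding hjb_solution_def by metis
  then show ?thesis by simp
qed

section \<open>Derivatives of the power transform\<close>

lemma D_x_deriv:
  "(\<lambda>u. f t u y) differentiable (at x) \<Longrightarrow> ((\<lambda>u. f t u y) has_real_derivative D_x f t x y) (at x)"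
  by (simp add: D_x_def DERIV_deriv_iff_real_differentiable)

lemma D_y_deriv:
  "(\<lambda>v. f t x v) differentiable (at y) \<Longrightarrow> ((\<lambda>v. f t x v) has_real_derivative D_y f t x y) (at y)"
  by (simp add: D_y_def DERIV_deriv_iff_real_differentiable)

lemma D_time_deriv:
  "(\<lambda>s. f s x y) differentiable (at t within {0..T}) \<Longrightarrow>
    ((\<lambda>s. f s x y) has_real_derivative D_time T f t x y) (at t within {0..T})"
  by (simp add: D_time_def has_real_derivative_iff_has_vector_derivative vector_derivative_works)

lemma has_real_derivative_imp_differentiable:
  "(f has_real_derivative D) F \<Longrightarrow> f differentiable F"
  by (auto simp: differentiable_def has_field_derivative_def)

lemma powr_time_reversal:
  assumes T: "0 < T" and \<tau>: "\<tau> \<in> {0..T}" and c: "c > 0"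
    and g: "g (T - \<tau>) x y > 0"
    and diff: "(\<lambda>s. g s x y) differentiable (at (T - \<tau>) within {0..T})"
    and \<phi>: "\<And>s. s \<in> {0..T} \<Longrightarrow> \<phi> s x y = (c * g (T - s) x y) powr p"
  shows "(\<lambda>s. \<phi> s x y) differentiable (at \<tau> within {0..T})"
    and "D_time T \<phi> \<tau> x y = - (p * \<phi> \<tau> x y * D_time T g (T - \<tau>) x y / g (T - \<tau>) x y)"
proof -
  \<comment> \<open>The reversal maps the closed interval onto itself, so the chain rule within it
    also covers the end points, where the derivatives are one-sided.\<close>
  have img: "(\<lambda>s. T - s) ` {0..T} = {0..T}"
    using image_diff_atLeastAtMost[of T 0 T] by simp
  have "((\<lambda>s. g s x y) \<circ> (\<lambda>s. T - s) has_real_derivative D_time T g (T - \<tau>) x y * (- 1))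
      (at \<tau> within {0..T})"
    by (rule DERIV_image_chain) (auto intro!: derivative_eq_intros D_time_deriv diff simp: img)
  then have "((\<lambda>s. g (T - s) x y) has_real_derivative - D_time T g (T - \<tau>) x y) (at \<tau> within {0..T})"
    by (simp add: o_def)
  from has_real_derivative_scaled_powr[OF this g c \<tau>, of p]
  have "((\<lambda>s. (c * g (T - s) x y) powr p) has_real_derivative
      - (p * \<phi> \<tau> x y * D_time T g (T - \<tau>) x y / g (T - \<tau>) x y)) (at \<tau> within {0..T})"
    by (simp add: \<phi>[OF \<tau>])
  \<comment> \<open>The formula for \<phi> is known only on \<open>{0..T}\<close>, so the derivative
    is transferred within that set.\<close>
  then have *: "((\<lambda>s. \<phi> s x y) has_real_derivative
      - (p * \<phi> \<tau> x y * D_time T g (T - \<tau>) x y / g (T - \<tau>) x y)) (at \<tau> within {0..T})"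
    by (rule has_field_derivative_transform_within[OF _ zero_less_one \<tau>]) (simp add: \<phi>)
  then show "(\<lambda>s. \<phi> s x y) differentiable (at \<tau> within {0..T})"
    by (rule has_real_derivative_imp_differentiable)
  \<comment> \<open>Derivatives within a nondegenerate closed interval are unique, so
    \<open>vector_derivative\<close> selects the value just found.\<close>
  show "D_time T \<phi> \<tau> x y = - (p * \<phi> \<tau> x y * D_time T g (T - \<tau>) x y / g (T - \<tau>) x y)"
    unfolding D_time_def[of T \<phi>]
    using vector_derivative_within_closed_interval[OF T \<tau>] *
    by (simp add: has_real_derivative_iff_has_vector_derivative)
qed

text \<open>The first-order formulas hold on the whole slice at time \<tau>, so they can be
  differentiated again by the product rule. The mixed derivative is taken in the order x, then y,
  throughout.\<close>

lemma powr_space_partials: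
  assumes part: "has_partials_on T I g" and t: "t \<in> I" and c: "c > 0"
    and g: "\<And>u v. g t u v > 0"
    and \<phi>: "\<And>u v. \<phi> \<tau> u v = (c * g t u v) powr p"
  shows "((\<lambda>u. \<phi> \<tau> u y) has_real_derivative p * \<phi> \<tau> x y * D_x g t x y / g t x y) (at x)" (is ?x)
    and "((\<lambda>v. \<phi> \<tau> x v) has_real_derivative p * \<phi> \<tau> x y * D_y g t x y / g t x y) (at y)" (is ?y)
    and "((\<lambda>u. D_x \<phi> \<tau> u y) has_real_derivative
          p * (D_x \<phi> \<tau> x y * D_x g t x y / g t x y + \<phi> \<tau> x y * D_x (D_x g) t x y / g t x y
            - \<phi> \<tau> x y * D_x g t x y * D_x g t x y / (g t x y)\<^sup>2)) (at x)" (is ?xx)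
    and "((\<lambda>v. D_y \<phi> \<tau> x v) has_real_derivative
          p * (D_y \<phi> \<tau> x y * D_y g t x y / g t x y + \<phi> \<tau> x y * D_y (D_y g) t x y / g t x y
            - \<phi> \<tau> x y * D_y g t x y * D_y g t x y / (g t x y)\<^sup>2)) (at y)" (is ?yy)
    and "((\<lambda>v. D_x \<phi> \<tau> x v) has_real_derivative
          p * (D_y \<phi> \<tau> x y * D_x g t x y / g t x y + \<phi> \<tau> x y * D_y (D_x g) t x y / g t x y
            - \<phi> \<tau> x y * D_x g t x y * D_y g t x y / (g t x y)\<^sup>2)) (at y)" (is ?xy)
proof -
  have d: "((\<lambda>u. g t u v) has_real_derivative D_x g t u v) (at u)"
      "((\<lambda>v. g t u v) has_real_derivative D_y g t u v) (at v)"
      "((\<lambda>u. D_x g t u v) has_real_derivative D_x (D_x g) t u v) (at u)"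
      "((\<lambda>v. D_y g t u v) has_real_derivative D_y (D_y g) t u v) (at v)"
      "((\<lambda>v. D_x g t u v) has_real_derivative D_y (D_x g) t u v) (at v)" for u v
    using part t by (auto simp: has_partials_on_def intro: D_x_deriv D_y_deriv)
  have x: "((\<lambda>u. \<phi> \<tau> u v) has_real_derivative p * \<phi> \<tau> u v * D_x g t u v / g t u v) (at u)" for u v
    unfolding \<phi> using has_real_derivative_scaled_powr[OF d(1) g c] by simp
  have y: "((\<lambda>v. \<phi> \<tau> u v) has_real_derivative p * \<phi> \<tau> u v * D_y g t u v / g t u v) (at v)" for u v
    unfolding \<phi> using has_real_derivative_scaled_powr[OF d(2) g c] by simp
  show ?x ?y by (rule x y)+
  have Dx: "D_x \<phi> \<tau> u v = p * \<phi> \<tau> u v * D_x g t u v / g t u v" for u v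
    unfolding D_x_def[of \<phi>] by (rule DERIV_imp_deriv[OF x])
  have Dy: "D_y \<phi> \<tau> u v = p * \<phi> \<tau> u v * D_y g t u v / g t u v" for u v
    unfolding D_y_def[of \<phi>] by (rule DERIV_imp_deriv[OF y])
  have nz: "g t u v \<noteq> 0" for u v using g[of u v] by simp
  show ?xx ?yy ?xy
    unfolding Dx Dy using nz[of x y]
    by (auto intro!: derivative_eq_intros x y d simp: field_simps power2_eq_square)
qed

lemma powr_space_D:
  assumes "has_partials_on T I g" and "t \<in> I" and "c > 0"
    and "\<And>u v. g t u v > 0"
    and "\<And>u v. \<phi> \<tau> u v = (c * g t u v) powr p"
  shows "D_x \<phi> \<tau> x y = p * \<phi> \<tau> x y * D_x g t x y / g t x y"
    and "D_y \<phi> \<tau> x y = p * \<phi> \<tau> x y * D_y g t x y / g t x y"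
    and "D_x (D_x \<phi>) \<tau> x y =
          p * (D_x \<phi> \<tau> x y * D_x g t x y / g t x y + \<phi> \<tau> x y * D_x (D_x g) t x y / g t x y
            - \<phi> \<tau> x y * D_x g t x y * D_x g t x y / (g t x y)\<^sup>2)"
    and "D_y (D_y \<phi>) \<tau> x y =
          p * (D_y \<phi> \<tau> x y * D_y g t x y / g t x y + \<phi> \<tau> x y * D_y (D_y g) t x y / g t x y
            - \<phi> \<tau> x y * D_y g t x y * D_y g t x y / (g t x y)\<^sup>2)"
    and "D_y (D_x \<phi>) \<tau> x y =
          p * (D_y \<phi> \<tau> x y * D_x g t x y / g t x y + \<phi> \<tau> x y * D_y (D_x g) t x y / g t x y
            - \<phi> \<tau> x y * D_x g t x y * D_y g t x y / (g t x y)\<^sup>2)"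
proof -
  note P = powr_space_partials[of T I g t c \<phi> \<tau> p, OF assms]
  note D = P(1,2)[THEN DERIV_imp_deriv, folded D_x_def D_y_def]
    P(3-5)[THEN DERIV_imp_deriv, folded D_x_def D_y_def]
  show "D_x \<phi> \<tau> x y = p * \<phi> \<tau> x y * D_x g t x y / g t x y"
    and "D_y \<phi> \<tau> x y = p * \<phi> \<tau> x y * D_y g t x y / g t x y"
    and "D_x (D_x \<phi>) \<tau> x y =
          p * (D_x \<phi> \<tau> x y * D_x g t x y / g t x y + \<phi> \<tau> x y * D_x (D_x g) t x y / g t x y
            - \<phi> \<tau> x y * D_x g t x y * D_x g t x y / (g t x y)\<^sup>2)"
    and "D_y (D_y \<phi>) \<tau> x y =
          p * (D_y \<phi> \<tau> x y * D_y g t x y / g t x y + \<phi> \<tau> x y * D_y (D_y g) t x y / g t x y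
            - \<phi> \<tau> x y * D_y g t x y * D_y g t x y / (g t x y)\<^sup>2)"
    and "D_y (D_x \<phi>) \<tau> x y =
          p * (D_y \<phi> \<tau> x y * D_x g t x y / g t x y + \<phi> \<tau> x y * D_y (D_x g) t x y / g t x y
            - \<phi> \<tau> x y * D_x g t x y * D_y g t x y / (g t x y)\<^sup>2)"
    by (rule D)+
qed

section \<open>The transform linearises the equation\<close>

lemma linear_lhs_transform:
  \<comment> \<open>The derivatives of \<open>\<phi>\<close> are those of \<open>((1 - \<gamma>) g)\<^sup>p\<close>, stated pointwise so that the claim
    is purely algebraic.\<close>
  assumes par: "0 < utility_exp M" "utility_exp M < 1" "-1 < corr M" "corr M < 1"
    and vol: "\<sigma>\<^sub>1 t x \<noteq> 0" "\<sigma>\<^sub>2 t y \<noteq> 0" and g: "g t x y \<noteq> 0" and t: "t = horizon M - \<tau>"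
    and p: "p = 1 / (1 - utility_exp M)"
    and Dt: "D_time (horizon M) \<phi> \<tau> x y = - (p * \<phi> \<tau> x y * D_time (horizon M) g t x y / g t x y)"
    and D: "D_x \<phi> \<tau> x y = p * \<phi> \<tau> x y * D_x g t x y / g t x y"
      "D_y \<phi> \<tau> x y = p * \<phi> \<tau> x y * D_y g t x y / g t x y"
      "D_x (D_x \<phi>) \<tau> x y =
          p * (D_x \<phi> \<tau> x y * D_x g t x y / g t x y + \<phi> \<tau> x y * D_x (D_x g) t x y / g t x y
            - \<phi> \<tau> x y * D_x g t x y * D_x g t x y / (g t x y)\<^sup>2)"
      "D_y (D_y \<phi>) \<tau> x y =
          p * (D_y \<phi> \<tau> x y * D_y g t x y / g t x y + \<phi> \<tau> x y * D_y (D_y g) t x y / g t x y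
            - \<phi> \<tau> x y * D_y g t x y * D_y g t x y / (g t x y)\<^sup>2)"
      "D_y (D_x \<phi>) \<tau> x y =
          p * (D_y \<phi> \<tau> x y * D_x g t x y / g t x y + \<phi> \<tau> x y * D_y (D_x g) t x y / g t x y
            - \<phi> \<tau> x y * D_x g t x y * D_y g t x y / (g t x y)\<^sup>2)"
  shows "linear_lhs M \<sigma>\<^sub>1 \<sigma>\<^sub>2 \<phi> \<tau> x y = p * \<phi> \<tau> x y / g t x y *
    (- D_time (horizon M) g t x y
     - hamiltonian M \<sigma>\<^sub>1 \<sigma>\<^sub>2 g t x y (maximiser M \<sigma>\<^sub>1 \<sigma>\<^sub>2 g t x y))"
proof -
  define G where "G = g t x y"
  define F where "F = \<phi> \<tau> x y"
  define Q where "Q = (drift1 M t x y - rate M)\<^sup>2 / (\<sigma>\<^sub>1 t x)\<^sup>2 + (drift2 M t x y - rate M)\<^sup>2 / (\<sigma>\<^sub>2 t y)\<^sup>2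
     - 2 * corr M * ((drift1 M t x y - rate M) * (drift2 M t x y - rate M) / (\<sigma>\<^sub>1 t x * \<sigma>\<^sub>2 t y))"
  define K where "K = Q / (1 - (corr M)\<^sup>2)"
  \<comment> \<open>Logarithmic derivatives make both sides polynomial.\<close>
  define gt where "gt = D_time (horizon M) g t x y / G"
  define gx where "gx = D_x g t x y / G"
  define gy where "gy = D_y g t x y / G"
  define gxx where "gxx = D_x (D_x g) t x y / G"
  define gyy where "gyy = D_y (D_y g) t x y / G"
  define gxy where "gxy = D_y (D_x g) t x y / G"
  have G: "G \<noteq> 0" using g by (simp add: G_def)
  have Dg: "D_time (horizon M) g t x y = gt * G" "D_x g t x y = gx * G" "D_y g t x y = gy * G"
    "D_x (D_x g) t x y = gxx * G" "D_y (D_y g) t x y = gyy * G" "D_y (D_x g) t x y = gxy * G"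
    using G by (simp_all add: gt_def gx_def gy_def gxx_def gyy_def gxy_def)
  have g_eq: "g t x y = G" and \<phi>_eq: "\<phi> \<tau> x y = F" by (simp_all add: G_def F_def)
  have D1: "D_time (horizon M) \<phi> \<tau> x y = - p * F * gt"
    "D_x \<phi> \<tau> x y = p * F * gx" "D_y \<phi> \<tau> x y = p * F * gy"
    unfolding Dt D(1,2) Dg g_eq \<phi>_eq using G by simp_all
  have D2: "D_x (D_x \<phi>) \<tau> x y = p * F * (p * gx\<^sup>2 + gxx - gx\<^sup>2)"
    "D_y (D_y \<phi>) \<tau> x y = p * F * (p * gy\<^sup>2 + gyy - gy\<^sup>2)"
    "D_y (D_x \<phi>) \<tau> x y = p * F * (p * gx * gy + gxy - gx * gy)"
    unfolding D(3-5) D1 Dg g_eq \<phi>_eq using G by (simp_all add: field_simps power2_eq_square)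
  have pc: "p * (1 - utility_exp M) = 1" using par p by simp
  have div: "a / (1 - utility_exp M) = a * p" "a / (utility_exp M - 1) = - a * p" for a
    using par by (simp_all add: p field_simps)
  have coeff: "utility_exp M / (2 * (utility_exp M - 1)\<^sup>2 * (1 - (corr M)\<^sup>2)) * Q = 1/2 * utility_exp M * p\<^sup>2 * K"
    by (simp add: K_def p power_divide power2_commute[of 1])
  \<comment> \<open>Every term of the linear equation is a multiple of \<open>p * F\<close>; both
    sides now become polynomials in the logarithmic derivatives of \<open>g\<close>.\<close>
  have lin: "linear_lhs M \<sigma>\<^sub>1 \<sigma>\<^sub>2 \<phi> \<tau> x y =
     (let \<gamma> = utility_exp M; r = rate M; \<rho> = corr M;
         m\<^sub>1 = drift1 M t x y; m\<^sub>2 = drift2 M t x y; s\<^sub>1 = \<sigma>\<^sub>1 t x; s\<^sub>2 = \<sigma>\<^sub>2 t y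
     in p * F * (- gt - 1/2 * \<gamma> * p * K - r * \<gamma>
        - m\<^sub>1 * p * gx + r * \<gamma> * p * gx + 1/2 * s\<^sub>1\<^sup>2 * gx
        - m\<^sub>2 * p * gy + r * \<gamma> * p * gy + 1/2 * s\<^sub>2\<^sup>2 * gy
        - 1/2 * s\<^sub>1\<^sup>2 * (p * gx\<^sup>2 + gxx - gx\<^sup>2) - 1/2 * s\<^sub>2\<^sup>2 * (p * gy\<^sup>2 + gyy - gy\<^sup>2)
        - \<rho> * s\<^sub>1 * s\<^sub>2 * (p * gx * gy + gxy - gx * gy)))"
    unfolding linear_lhs_def Let_def t[symmetric] Q_def[symmetric] coeff D1 D2 div \<phi>_eq
    by algebra
  have ham: "hamiltonian M \<sigma>\<^sub>1 \<sigma>\<^sub>2 g t x y (maximiser M \<sigma>\<^sub>1 \<sigma>\<^sub>2 g t x y) =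
     (let \<gamma> = utility_exp M; r = rate M; \<rho> = corr M;
         m\<^sub>1 = drift1 M t x y; m\<^sub>2 = drift2 M t x y; s\<^sub>1 = \<sigma>\<^sub>1 t x; s\<^sub>2 = \<sigma>\<^sub>2 t y
     in G * (r * \<gamma> + (m\<^sub>1 - 1/2 * s\<^sub>1\<^sup>2) * gx + (m\<^sub>2 - 1/2 * s\<^sub>2\<^sup>2) * gy
        + 1/2 * s\<^sub>1\<^sup>2 * gxx + 1/2 * s\<^sub>2\<^sup>2 * gyy + \<rho> * s\<^sub>1 * s\<^sub>2 * gxy
        + 1/2 * \<gamma> * p * (K + 2 * ((m\<^sub>1 - r) * gx + (m\<^sub>2 - r) * gy)
            + s\<^sub>1\<^sup>2 * gx\<^sup>2 + s\<^sub>2\<^sup>2 * gy\<^sup>2 + 2 * \<rho> * s\<^sub>1 * s\<^sub>2 * gx * gy)))"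
    unfolding hamiltonian_completed_square(2)[of M \<sigma>\<^sub>1 t x \<sigma>\<^sub>2 y g, OF par vol g]
      Q_def[symmetric] K_def[symmetric] div
    unfolding hamiltonian_def Let_def zero_prod_def case_prod_conv Dg g_eq
    using G by (simp add: field_simps power2_eq_square)
  have "p * F / G * (- (gt * G) - G * h) = p * F * (- gt - h)" for h
    using G by (simp add: field_simps)
  note cancel = this
  \<comment> \<open>Here \<open>p\<close> and \<gamma> are treated as independent, which makes this
    a polynomial identity. Everything that does not cancel, including the quadratic gradient terms,
    carries the factor \<open>p * (1 - utility_exp M) - 1\<close>, which is zero for the chosen
    exponent.\<close>
  have "linear_lhs M \<sigma>\<^sub>1 \<sigma>\<^sub>2 \<phi> \<tau> x y = p * F / G *
      (- (gt * G) - hamiltonian M \<sigma>\<^sub>1 \<sigma>\<^sub>2 g t x y (maximiser M \<sigma>\<^sub>1 \<sigma>\<^sub>2 g t x y))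
      - p * F * (p * (1 - utility_exp M) - 1) * (drift1 M t x y * gx + drift2 M t x y * gy
        + 1/2 * (\<sigma>\<^sub>1 t x)\<^sup>2 * gx\<^sup>2 + 1/2 * (\<sigma>\<^sub>2 t y)\<^sup>2 * gy\<^sup>2 + corr M * \<sigma>\<^sub>1 t x * \<sigma>\<^sub>2 t y * gx * gy)"
    unfolding lin ham unfolding Let_def cancel by algebra
  then show ?thesis
    by (simp add: pc g_eq[symmetric] \<phi>_eq[symmetric] Dg(1))
qed

section \<open>Assembling the reduction\<close>

lemma reduction_claim_nonzero_volatility:
  assumes T: "horizon M > 0"
    and par: "0 < utility_exp M" "utility_exp M < 1" "-1 < corr M" "corr M < 1"
    and vol: "\<And>t x. t \<in> {0..<horizon M} \<Longrightarrow> \<sigma>\<^sub>1 t x \<noteq> 0"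
      "\<And>t y. t \<in> {0..<horizon M} \<Longrightarrow> \<sigma>\<^sub>2 t y \<noteq> 0"
  shows "reduction_claim M \<sigma>\<^sub>1 \<sigma>\<^sub>2"
proof -
  define T where "T = horizon M"
  define c where "c = 1 - utility_exp M"
  define p where "p = 1 / c"
  have c: "c > 0" and pc: "p * c = 1" "c * p = 1" using par by (auto simp: c_def p_def)
  have T: "T > 0" using T by (simp add: T_def)
  have claim: "(\<forall>t\<in>{0..<T}. \<forall>x y \<pi>.
          optimal_controls M \<sigma>\<^sub>1 \<sigma>\<^sub>2 g t x y \<pi> \<longleftrightarrow> \<pi> = maximiser M \<sigma>\<^sub>1 \<sigma>\<^sub>2 g t x y) \<and>
       (\<exists>\<phi>. power_transform M g \<phi>) \<and>
       (\<forall>\<phi>. power_transform M g \<phi> \<longrightarrow>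
          linear_solution M \<sigma>\<^sub>1 \<sigma>\<^sub>2 \<phi> \<and>
          (\<forall>t\<in>{0..<T}. \<forall>x y \<pi>.
             optimal_controls M \<sigma>\<^sub>1 \<sigma>\<^sub>2 g t x y \<pi> \<longleftrightarrow>
             \<pi> = control_formula M \<sigma>\<^sub>1 \<sigma>\<^sub>2 t x y
                   (D_x \<phi> (T - t) x y / \<phi> (T - t) x y)
                   (D_y \<phi> (T - t) x y / \<phi> (T - t) x y)))"
    if hjb: "hjb_solution M \<sigma>\<^sub>1 \<sigma>\<^sub>2 g" and nz: "\<forall>t\<in>{0..<T}. \<forall>x y. g t x y \<noteq> 0" for g
  proof (intro conjI)
    \<comment> \<open>The equation gives positivity before the horizon; at the horizon it comes from
      the terminal value 1.\<close>
    have pos: "g t x y > 0" if "t \<in> {0..T}" for t x y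
    proof (cases "t = T")
      case True
      then show ?thesis using hjb by (simp add: hjb_solution_def T_def)
    next
      case False
      with that have t: "t \<in> {0..<horizon M}" by (simp add: T_def)
      show ?thesis
        by (rule hjb_solution_pos[OF par vol[OF t] hjb t]) (use nz t in \<open>auto simp: T_def\<close>)
    qed
    have part: "has_partials_on T {0..<T} g" and final: "g T x y = 1" for x y
      using hjb by (auto simp: hjb_solution_def T_def)
    show opt: "\<forall>t\<in>{0..<T}. \<forall>x y \<pi>.
        optimal_controls M \<sigma>\<^sub>1 \<sigma>\<^sub>2 g t x y \<pi> \<longleftrightarrow> \<pi> = maximiser M \<sigma>\<^sub>1 \<sigma>\<^sub>2 g t x y"
      by (intro ballI allI optimal_controls_iff par vol pos) (auto simp: T_def)
    \<comment> \<open>The witness solves \<open>g = 1 / c * \<phi> powr c\<close> for \<phi>, with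
      \<open>p = 1 / c\<close>.\<close>
    have "power_transform M g (\<lambda>s x y. (c * g (T - s) x y) powr p)"
      unfolding power_transform_def T_def[symmetric] c_def[symmetric]
    proof (intro ballI allI conjI)
      fix t x y assume t: "t \<in> {0..T}"
      have cg: "c * g t x y > 0" using c pos[OF t] by simp
      then show "(c * g (T - (T - t)) x y) powr p > 0"
        using c pos[OF t, of x y] by simp
      show "g t x y = 1 / c * ((c * g (T - (T - t)) x y) powr p) powr c"
        using cg by (auto simp: powr_powr pc)
    qed
    then show "\<exists>\<phi>. power_transform M g \<phi>" by blast
    show "\<forall>\<phi>. power_transform M g \<phi> \<longrightarrow>
          linear_solution M \<sigma>\<^sub>1 \<sigma>\<^sub>2 \<phi> \<and>
          (\<forall>t\<in>{0..<T}. \<forall>x y \<pi>.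
             optimal_controls M \<sigma>\<^sub>1 \<sigma>\<^sub>2 g t x y \<pi> \<longleftrightarrow>
             \<pi> = control_formula M \<sigma>\<^sub>1 \<sigma>\<^sub>2 t x y
                   (D_x \<phi> (T - t) x y / \<phi> (T - t) x y)
                   (D_y \<phi> (T - t) x y / \<phi> (T - t) x y))"
    proof (intro allI impI conjI)
      fix \<phi> assume "power_transform M g \<phi>"
      then have tr: "\<phi> (T - t) x y > 0" "g t x y = 1 / c * \<phi> (T - t) x y powr c"
        if "t \<in> {0..T}" for t x y
        using that by (auto simp: power_transform_def T_def c_def)
      \<comment> \<open>Every admissible \<phi> coincides with that witness on
        \<open>{0..T}\<close>, so its derivatives follow from those of \<open>g\<close>.\<close>
      have \<phi>: "\<phi> s x y > 0" "\<phi> s x y = (c * g (T - s) x y) powr p" if "s \<in> {0..T}" for s x y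
        using tr[of "T - s" x y] that c by (auto simp: powr_powr pc)
      have space: "D_x \<phi> s x y = p * \<phi> s x y * D_x g (T - s) x y / g (T - s) x y"
        "D_y \<phi> s x y = p * \<phi> s x y * D_y g (T - s) x y / g (T - s) x y"
        if "s \<in> {0<..T}" for s x y
        using powr_space_D(1,2)[OF part _ c, of "T - s" \<phi> s p x y] pos[of "T - s"] \<phi>(2)[of s] that
        by auto
      show "\<forall>t\<in>{0..<T}. \<forall>x y \<pi>.
             optimal_controls M \<sigma>\<^sub>1 \<sigma>\<^sub>2 g t x y \<pi> \<longleftrightarrow>
             \<pi> = control_formula M \<sigma>\<^sub>1 \<sigma>\<^sub>2 t x y
                   (D_x \<phi> (T - t) x y / \<phi> (T - t) x y)
                   (D_y \<phi> (T - t) x y / \<phi> (T - t) x y)"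
      proof (intro ballI allI)
        fix t x y \<pi> assume t: "t \<in> {0..<T}"
        have "\<phi> (T - t) x y \<noteq> 0" using tr(1)[of t x y] t by simp
        then have "D_x \<phi> (T - t) x y / \<phi> (T - t) x y = D_x g t x y / (c * g t x y)"
          "D_y \<phi> (T - t) x y / \<phi> (T - t) x y = D_y g t x y / (c * g t x y)"
          using space[of "T - t" x y] t by (simp_all add: p_def)
        then show "optimal_controls M \<sigma>\<^sub>1 \<sigma>\<^sub>2 g t x y \<pi> \<longleftrightarrow>
             \<pi> = control_formula M \<sigma>\<^sub>1 \<sigma>\<^sub>2 t x y
                   (D_x \<phi> (T - t) x y / \<phi> (T - t) x y)
                   (D_y \<phi> (T - t) x y / \<phi> (T - t) x y)"
          by (simp only: c_def opt[rule_format, OF t])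
      qed
      show "linear_solution M \<sigma>\<^sub>1 \<sigma>\<^sub>2 \<phi>"
        unfolding linear_solution_def T_def[symmetric] c_def[symmetric] p_def[symmetric]
      proof (intro conjI ballI allI)
        fix x y
        show "\<phi> 0 x y = c powr p" using \<phi>(2)[of 0 x y] T by (simp add: final)
      next
        have time: "(\<lambda>s. \<phi> s x y) differentiable (at s within {0..T})"
          "D_time T \<phi> s x y = - (p * \<phi> s x y * D_time T g (T - s) x y / g (T - s) x y)"
          if "s \<in> {0<..T}" for s x y
        proof -
          have s: "s \<in> {0..T}" "T - s \<in> {0..<T}" "T - s \<in> {0..T}" using that by auto
          have diff: "(\<lambda>s. g s x y) differentiable (at (T - s) within {0..T})"
            using part s by (auto simp: has_partials_on_def)
          note * = powr_time_reversal[where g = g and \<phi> = \<phi> and x = x and y = y and p = p,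
              OF T s(1) c pos[OF s(3)] diff]
          show "(\<lambda>s. \<phi> s x y) differentiable (at s within {0..T})"
            "D_time T \<phi> s x y = - (p * \<phi> s x y * D_time T g (T - s) x y / g (T - s) x y)"
            by (rule *, rule \<phi>(2), assumption)+
        qed
        \<comment> \<open>The reversal sends \<open>{0<..T}\<close> to \<open>{0..<T}\<close>: the
          linear equation omits \<tau> = 0 exactly as the equation for \<open>g\<close> omits the
          horizon.\<close>
        have sp: "T - s \<in> {0..<T}" "\<And>u v. g (T - s) u v > 0"
          "\<And>u v. \<phi> s u v = (c * g (T - s) u v) powr p" if "s \<in> {0<..T}" for s
          using that pos[of "T - s"] \<phi>(2)[of s] by simp_all
        show "has_partials_on T {0<..T} \<phi>"
          unfolding has_partials_on_def
          by (intro ballI allI conjI time(1)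
              powr_space_partials[THEN has_real_derivative_imp_differentiable, OF part sp(1) c sp(2,3)])
        fix s x y assume s: "s \<in> {0<..T}"
        have t: "T - s \<in> {0..<horizon M}" using sp(1)[OF s] by (simp add: T_def)
        have gnz: "g (T - s) x y \<noteq> 0" using sp(2)[OF s, of x y] by simp
        note D = powr_space_D[where g = g and \<phi> = \<phi> and t = "T - s" and \<tau> = s and p = p,
            OF part sp(1)[OF s] c sp(2)[OF s] sp(3)[OF s]]
        have "linear_lhs M \<sigma>\<^sub>1 \<sigma>\<^sub>2 \<phi> s x y = p * \<phi> s x y / g (T - s) x y *
            (- D_time (horizon M) g (T - s) x y - hamiltonian M \<sigma>\<^sub>1 \<sigma>\<^sub>2 g (T - s) x y
              (maximiser M \<sigma>\<^sub>1 \<sigma>\<^sub>2 g (T - s) x y))"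
          by (rule linear_lhs_transform[where \<sigma>\<^sub>1 = \<sigma>\<^sub>1 and \<sigma>\<^sub>2 = \<sigma>\<^sub>2 and t = "T - s" and g = g
                and x = x and y = y, OF par vol[OF t] gnz])
            (use D[of x y] time(2)[OF s, of x y] in \<open>simp_all add: T_def p_def c_def\<close>)
        \<comment> \<open>The factor in parentheses is the defect of the Hamilton-Jacobi-Bellman
          equation, which vanishes.\<close>
        then show "linear_lhs M \<sigma>\<^sub>1 \<sigma>\<^sub>2 \<phi> s x y = 0"
          using hjb_solution_D_time[where x = x and y = y, OF par vol[OF t] hjb t gnz] by simp
      qed
    qed
  qed
  show ?thesis
    unfolding reduction_claim_def T_def[symmetric] by (intro allI impI, elim conjE) (rule claim)
qed

theorem mainTheorem1:
  fixes M :: market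
  assumes "horizon M > 0" and "rate M > 0"
    and "0 < utility_exp M" and "utility_exp M < 1"
    and "-1 < corr M" and "corr M < 1"
  shows "(\<forall>\<sigma>\<^sub>1 \<sigma>\<^sub>2.
            (\<forall>t\<in>{0..<horizon M}. \<forall>x. \<sigma>\<^sub>1 t x \<noteq> 0) \<and>
            (\<forall>t\<in>{0..<horizon M}. \<forall>y. \<sigma>\<^sub>2 t y \<noteq> 0) \<longrightarrow>
            reduction_claim M \<sigma>\<^sub>1 \<sigma>\<^sub>2) \<and>
         (\<forall>s\<^sub>1 s\<^sub>2 \<theta>\<^sub>1 \<theta>\<^sub>2.
            s\<^sub>1 > 0 \<and> s\<^sub>2 > 0 \<and> \<theta>\<^sub>1 \<in> {-1<..<0} \<and> \<theta>\<^sub>2 \<in> {-1<..<0} \<longrightarrow>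
            reduction_claim M (cev s\<^sub>1 \<theta>\<^sub>1) (cev s\<^sub>2 \<theta>\<^sub>2))"
proof (intro conjI allI impI; elim conjE)
  fix \<sigma>\<^sub>1 \<sigma>\<^sub>2 :: volatility
  assume "\<forall>t\<in>{0..<horizon M}. \<forall>x. \<sigma>\<^sub>1 t x \<noteq> 0" "\<forall>t\<in>{0..<horizon M}. \<forall>y. \<sigma>\<^sub>2 t y \<noteq> 0"
  then show "reduction_claim M \<sigma>\<^sub>1 \<sigma>\<^sub>2"
    by (intro reduction_claim_nonzero_volatility assms(1,3-6)) blast+
next
  fix s\<^sub>1 s\<^sub>2 \<theta>\<^sub>1 \<theta>\<^sub>2 :: real
  \<comment> \<open>A positive multiple of an exponential never vanishes, so this is an instance of
    the general case.\<close>
  assume "s\<^sub>1 > 0" "s\<^sub>2 > 0"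
  then show "reduction_claim M (cev s\<^sub>1 \<theta>\<^sub>1) (cev s\<^sub>2 \<theta>\<^sub>2)"
    by (intro reduction_claim_nonzero_volatility assms(1,3-6)) (simp_all add: cev_def)
qed

end
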